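(* Let $k \in \mathbb{N}$ with $k \geq 2$, and let $h(2,k)$ be the minimum link-length of a polygonal chain in $\mathbb{R}^k$ that visits all the points of $H(2,k) = \{0,1\}^k \subset \mathbb{R}^k$. Then $h(2,k) \geq 3 \cdot 2^{k-2}$.
   Context: A polygonal chain with $m$ links (i.e. of link-length $m$) in $\mathbb{R}^k$ is given by a sequence of $m+1$ vertices $S_1, S_2, \dots, S_{m+1} \in \mathbb{R}^k$ (arbitrary points, not necessarily in $\{0,1\}^k$ or in $[0,1]^k$); its links are the closed line segments $\overline{S_1S_2}, \overline{S_2S_3}, \dots, \overline{S_mS_{m+1}}$, and as a point set it is $\mathcal{P}(m) = \overline{S_1S_2} \cup \overline{S_2S_3} \cup \dots \cup \overline{S_mS_{m+1}}$. Self-intersections are allowed. The chain visits (covers) a point set $X$ if $X \subset \mathcal{P}(m)$. $H(2,k) = \{0,1\}^k \subset \mathbb{R}^k$ is the set of the $2^k$ nodes of the hypercube $[0,1]^k$. $h(2,k)$ is the smallest $m$ for which there is a polygonal chain with $m$ links covering $H(2,k)$. *)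

theory Defs
  imports "HOL-Analysis.Analysis"
begin

text \<open>The chain with \<open>m\<close> links is given by its vertices \<open>S 1, \<dots>, S (m + 1)\<close>; the values of \<open>S\<close>
  at other indices are irrelevant. Consecutive vertices may coincide.\<close>

definition polygonal_chain :: "nat \<Rightarrow> (nat \<Rightarrow> 'a::real_vector) \<Rightarrow> 'a set" where
  "polygonal_chain m S = (\<Union>i\<in>{1..m}. closed_segment (S i) (S (i + 1)))"

definition min_link_length :: "'a::real_vector set \<Rightarrow> nat" where
  "min_link_length X = (LEAST m. \<exists>S. X \<subseteq> polygonal_chain m S)"

text \<open>\<open>H(2,k)\<close> with \<open>k = CARD('n)\<close>.\<close>

definition hypercube_nodes :: "(real ^ 'n) set" where
  "hypercube_nodes = {x. \<forall>i. x $ i \<in> {0, 1}}"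

text \<open>A finite set is always covered by some chain, so the minimum above is attained and the
  \<open>LEAST\<close> is not a junk value.\<close>

lemma finite_covered_by_chain:
  assumes "finite X"
  shows "\<exists>m S. X \<subseteq> polygonal_chain m S"
proof -
  obtain xs where xs: "set xs = X"
    using finite_list[OF assms] by blast
  have "X \<subseteq> polygonal_chain (length xs) (\<lambda>i. xs ! (i - 1))"
  proof
    fix x assume "x \<in> X"
    then obtain j where "j < length xs" "xs ! j = x"
      using xs by (metis in_set_conv_nth)
    then show "x \<in> polygonal_chain (length xs) (\<lambda>i. xs ! (i - 1))"
      unfolding polygonal_chain_def by (intro UN_I[of "Suc j"]) auto
  qed
  then show ?thesis by blast
qed

lemma finite_hypercube_nodes: "finite (hypercube_nodes :: (real ^ 'n) set)"
proof -
  have "hypercube_nodes \<subseteq> range (\<lambda>A :: 'n set. \<chi> i. if i \<in> A then 1 else (0::real))"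
  proof
    fix x :: "real ^ 'n" assume "x \<in> hypercube_nodes"
    then have "x = (\<chi> i. if i \<in> {i. x $ i = 1} then 1 else 0)"
      by (auto simp: hypercube_nodes_def vec_eq_iff)
    then show "x \<in> range (\<lambda>A :: 'n set. \<chi> i. if i \<in> A then 1 else (0::real))"
      by blast
  qed
  then show ?thesis
    by (rule finite_subset) simp
qed

lemma min_link_length_attained:
  "\<exists>S. (hypercube_nodes :: (real ^ 'n) set)
     \<subseteq> polygonal_chain (min_link_length (hypercube_nodes :: (real ^ 'n) set)) S"
  unfolding min_link_length_def
  by (rule LeastI_ex) (rule finite_covered_by_chain[OF finite_hypercube_nodes])

end

theory Submission
  imports Defs
begin

text \<open>
  Give every node of the cube to the first link that covers it. The bound follows once any three
  consecutive links are known to receive at most four nodes altogether, and any two consecutive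
  links at most three: a chain with \<open>3 * q + 2\<close> links then receives at most \<open>4 * q + 3\<close> nodes, so
  \<open>4 * 2 ^ (k - 2)\<close> nodes cannot be covered with fewer than \<open>3 * 2 ^ (k - 2)\<close> links.

  Both estimates come from looking at a vertex \<open>P\<close> where a link ends. If the link contains two
  nodes \<open>a\<close> and \<open>b\<close>, with \<open>b\<close> nearer to \<open>P\<close>, then \<open>P = a + s (b - a)\<close> with \<open>s \<ge> 1\<close>. In a
  coordinate where \<open>b\<close> is 1 this is at least 1, and where \<open>b\<close> is 0 it is at most 0. So \<open>b\<close> is
  determined by \<open>P\<close> alone (\<open>segment_two_nodes\<close>). Consequently

  \<^item> a link contains at most two nodes, as any two of its nodes include the one determined by \<open>P\<close>;

  \<^item> two consecutive links cannot receive two nodes each, as both would receive the node determined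
    by their common vertex;

  \<^item> three consecutive links cannot receive two, one and two nodes. Here the middle link runs from
    \<open>P = a + s (b - a)\<close> to \<open>Q = c + t (d - c)\<close> and contains a node \<open>e\<close> with coordinates 0 and 1.
    This is so restrictive in each coordinate that two of \<open>a, b, c, d\<close> coincide
    (\<open>no_node_between\<close>).
\<close>

section \<open>The node determined by the end of a link\<close>

definition outer_node :: "real ^ 'n \<Rightarrow> real ^ 'n" where
  "outer_node P = (\<chi> i. if 1 \<le> P $ i then 1 else 0)"

lemma hypercube_nodes_cases:
  assumes "x \<in> hypercube_nodes"
  shows "x $ i = 0 \<or> x $ i = 1"
  using assms by (auto simp: hypercube_nodes_def)

text \<open>Moving beyond \<open>b\<close> on the ray from \<open>a\<close> pushes each coordinate either not at all or away from
  the interval between 0 and 1, on the side of \<open>b\<close>.\<close>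

lemma outer_node_ray:
  assumes a: "a \<in> hypercube_nodes" and b: "b \<in> hypercube_nodes" and s: "1 \<le> s"
  shows "outer_node (a + s *\<^sub>R (b - a)) = b"
proof -
  have "outer_node (a + s *\<^sub>R (b - a)) $ i = b $ i" for i
    using hypercube_nodes_cases[OF a, of i] hypercube_nodes_cases[OF b, of i] s
    by (auto simp: outer_node_def)
  then show ?thesis by (simp add: vec_eq_iff)
qed

lemma outer_node_of_node:
  assumes "x \<in> hypercube_nodes"
  shows "outer_node x = x"
  using outer_node_ray[OF assms assms, of 1] by simp

lemma segment_end_on_ray:
  fixes X P :: "'a::real_vector"
  assumes x: "x \<in> closed_segment X P" and y: "y \<in> closed_segment X P" and "x \<noteq> y"
  obtains s where "1 \<le> s" "P = x + s *\<^sub>R (y - x)"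
    | s where "1 \<le> s" "P = y + s *\<^sub>R (x - y)"
proof -
  have ray: "\<exists>s\<ge>1. P = (X + \<alpha> *\<^sub>R (P - X)) + s *\<^sub>R ((X + \<beta> *\<^sub>R (P - X)) - (X + \<alpha> *\<^sub>R (P - X)))"
    if "\<alpha> < \<beta>" "\<beta> \<le> 1" for \<alpha> \<beta> :: real
  proof (intro exI conjI)
    show "1 \<le> (1 - \<alpha>) / (\<beta> - \<alpha>)"
      using that by (simp add: field_simps)
    have "((1 - \<alpha>) / (\<beta> - \<alpha>)) * (\<beta> - \<alpha>) = 1 - \<alpha>"
      using that by simp
    then have "((1 - \<alpha>) / (\<beta> - \<alpha>)) *\<^sub>R ((\<beta> - \<alpha>) *\<^sub>R (P - X)) = (1 - \<alpha>) *\<^sub>R (P - X)"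
      by (metis scaleR_scaleR)
    then show "P = (X + \<alpha> *\<^sub>R (P - X)) + ((1 - \<alpha>) / (\<beta> - \<alpha>)) *\<^sub>R
        ((X + \<beta> *\<^sub>R (P - X)) - (X + \<alpha> *\<^sub>R (P - X)))"
      by (simp add: scaleR_left_diff_distrib)
  qed
  obtain \<alpha> where \<alpha>: "\<alpha> \<le> 1" "x = X + \<alpha> *\<^sub>R (P - X)"
    using x by (auto simp: in_segment algebra_simps)
  obtain \<beta> where \<beta>: "\<beta> \<le> 1" "y = X + \<beta> *\<^sub>R (P - X)"
    using y by (auto simp: in_segment algebra_simps)
  have "\<alpha> \<noteq> \<beta>" using \<alpha> \<beta> \<open>x \<noteq> y\<close> by auto
  then consider "\<alpha> < \<beta>" | "\<beta> < \<alpha>" by linarith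
  then show ?thesis
  proof cases
    case 1
    then show ?thesis using ray[OF 1] \<alpha> \<beta> that(1) by blast
  next
    case 2
    then show ?thesis using ray[OF 2] \<alpha> \<beta> that(2) by blast
  qed
qed

lemma segment_two_nodes:
  assumes "x \<in> hypercube_nodes \<inter> closed_segment X P"
    and "y \<in> hypercube_nodes \<inter> closed_segment X P" and "x \<noteq> y"
  obtains a s where "{x, y} = {a, outer_node P}" "a \<noteq> outer_node P" "1 \<le> s"
    "P = a + s *\<^sub>R (outer_node P - a)"
proof (rule segment_end_on_ray[of x X P y])
  fix s :: real assume "1 \<le> s" "P = x + s *\<^sub>R (y - x)"
  moreover from this have "outer_node P = y"
    using outer_node_ray[of x y s] assms by simp
  ultimately show thesis
    using that[of x s] assms by simp
next
  fix s :: real assume "1 \<le> s" "P = y + s *\<^sub>R (x - y)"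
  moreover from this have "outer_node P = x"
    using outer_node_ray[of y x s] assms by simp
  ultimately show thesis
    using that[of y s] assms by (simp add: insert_commute)
qed (use assms in auto)

section \<open>Nodes on consecutive links\<close>

lemma card_nodes_on_segment_le:
  assumes "A \<subseteq> hypercube_nodes \<inter> closed_segment X P"
  shows "card A \<le> 2"
proof -
  \<comment> \<open>Two distinct nodes of the link cannot both differ from the outer node.\<close>
  have "x = y" if "x \<in> A - {outer_node P}" "y \<in> A - {outer_node P}" for x y
  proof (rule ccontr)
    assume "x \<noteq> y"
    have "x \<in> hypercube_nodes \<inter> closed_segment X P" "y \<in> hypercube_nodes \<inter> closed_segment X P"
      using assms that by auto
    then obtain a where "{x, y} = {a, outer_node P}"
      using segment_two_nodes[OF _ _ \<open>x \<noteq> y\<close>] by metis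
    then have "outer_node P \<in> {x, y}" by simp
    then show False using that by auto
  qed
  moreover have "finite A"
    using assms finite_hypercube_nodes by (meson Int_lower1 finite_subset subset_trans)
  ultimately have "card (A - {outer_node P}) \<le> 1"
    by (auto simp: card_le_Suc0_iff_eq)
  then show ?thesis
    by (simp add: card_Diff_singleton_if split: if_splits)
qed

lemma outer_node_in_pair:
  assumes A: "A \<subseteq> hypercube_nodes \<inter> closed_segment X P" and "card A = 2"
  obtains a s where "A = {a, outer_node P}" "a \<noteq> outer_node P" "1 \<le> s"
    "P = a + s *\<^sub>R (outer_node P - a)"
proof -
  obtain x y where xy: "A = {x, y}" "x \<noteq> y"
    using \<open>card A = 2\<close> by (auto simp: card_2_iff)
  with A have "x \<in> hypercube_nodes \<inter> closed_segment X P" "y \<in> hypercube_nodes \<inter> closed_segment X P"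
    by auto
  from segment_two_nodes[OF this \<open>x \<noteq> y\<close>] xy(1) that show thesis by metis
qed

lemma card_nodes_on_two_links:
  assumes A: "A \<subseteq> hypercube_nodes \<inter> closed_segment X P"
    and B: "B \<subseteq> hypercube_nodes \<inter> closed_segment P Q"
    and "A \<inter> B = {}"
  shows "card A + card B \<le> 3"
proof -
  have B': "B \<subseteq> hypercube_nodes \<inter> closed_segment Q P"
    using B by (simp add: closed_segment_commute)
  have "\<not> (card A = 2 \<and> card B = 2)"
  proof
    assume "card A = 2 \<and> card B = 2"
    then have "outer_node P \<in> A" "outer_node P \<in> B"
      using outer_node_in_pair[OF A] outer_node_in_pair[OF B'] by blast+
    then show False using \<open>A \<inter> B = {}\<close> by blast
  qed
  then show ?thesis
    using card_nodes_on_segment_le[OF A] card_nodes_on_segment_le[OF B] by linarith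
qed

text \<open>One coordinate of the situation where \<open>e\<close> lies strictly between \<open>P = a + s (b - a)\<close> and
  \<open>Q = c + t (d - c)\<close>. If \<open>b = d\<close>, then \<open>P\<close> and \<open>Q\<close> are on the same side of the open unit interval,
  so \<open>e\<close> can only be reached when neither is pushed outwards. If \<open>b \<noteq> d\<close>, then \<open>e\<close> would be strictly
  inside the unit interval unless one of them is pushed outwards. If exactly one is, the factor \<open>s\<close>
  or \<open>t\<close> is forced, namely \<open>1 / (1 - u)\<close> or \<open>1 / u\<close>. With both factors of this size, pushing \<open>P\<close> and
  \<open>Q\<close> outwards in the same coordinate would put \<open>e\<close> at \<open>u\<close> or \<open>1 - u\<close>, inside the interval again.\<close>

lemma coordinate_between:
  fixes a b c d e s t u :: real
  assumes nodes: "a = 0 \<or> a = 1" "b = 0 \<or> b = 1" "c = 0 \<or> c = 1" "d = 0 \<or> d = 1" "e = 0 \<or> e = 1"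
    and st: "1 \<le> s" "1 \<le> t" and u: "0 < u" "u < 1"
    and e: "e = (1 - u) * (a + s * (b - a)) + u * (c + t * (d - c))"
  shows "b = d \<Longrightarrow> (s = 1 \<or> a = b) \<and> (t = 1 \<or> c = d)"
    and "b \<noteq> d \<Longrightarrow> (1 < s \<and> a \<noteq> b) \<or> (1 < t \<and> c \<noteq> d)"
    and "b \<noteq> d \<Longrightarrow> c = d \<Longrightarrow> (1 - u) * s = 1"
    and "b \<noteq> d \<Longrightarrow> a = b \<Longrightarrow> u * t = 1"
    and "(1 - u) * s = 1 \<Longrightarrow> u * t = 1 \<Longrightarrow> b \<noteq> d \<Longrightarrow> a = b \<or> c = d"
proof -
  \<comment> \<open>How far the outward pushes of \<open>P\<close> and \<open>Q\<close> move \<open>e\<close>; in these terms \<open>e\<close> depends linearly on the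
    parameters once the nodes are fixed.\<close>
  define p q where "p = (1 - u) * (s - 1)" and "q = u * (t - 1)"
  have p: "0 \<le> p" "p = 0 \<longleftrightarrow> s = 1" and q: "0 \<le> q" "q = 0 \<longleftrightarrow> t = 1"
    using st u by (simp_all add: p_def q_def)
  have ps: "(1 - u) * s = 1 \<longleftrightarrow> p = u" and qt: "u * t = 1 \<longleftrightarrow> q = 1 - u"
    by (auto simp: p_def q_def right_diff_distrib)
  have e': "e = (1 - u) * b + p * (b - a) + (u * d + q * (d - c))"
    unfolding e p_def q_def by (simp add: algebra_simps)
  show "b = d \<Longrightarrow> (s = 1 \<or> a = b) \<and> (t = 1 \<or> c = d)"
    unfolding p(2)[symmetric] q(2)[symmetric]
    using nodes e' p(1) q(1) u by (elim disjE) simp_all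
  have "b \<noteq> d \<Longrightarrow> (p \<noteq> 0 \<and> a \<noteq> b) \<or> (q \<noteq> 0 \<and> c \<noteq> d)"
    using nodes e' p(1) q(1) u by (elim disjE) auto
  then show "b \<noteq> d \<Longrightarrow> (1 < s \<and> a \<noteq> b) \<or> (1 < t \<and> c \<noteq> d)"
    using p(2) q(2) st by auto
  show "b \<noteq> d \<Longrightarrow> c = d \<Longrightarrow> (1 - u) * s = 1"
    unfolding ps using nodes e' p(1) q(1) u by (elim disjE) simp_all
  show "b \<noteq> d \<Longrightarrow> a = b \<Longrightarrow> u * t = 1"
    unfolding qt using nodes e' p(1) q(1) u by (elim disjE) simp_all
  show "(1 - u) * s = 1 \<Longrightarrow> u * t = 1 \<Longrightarrow> b \<noteq> d \<Longrightarrow> a = b \<or> c = d"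
    unfolding ps qt using nodes e' u by (elim disjE) simp_all
qed

text \<open>Combining all coordinates, \<open>coordinate_between\<close> makes two endpoints of disjoint pairs equal in
  every case. If \<open>s = 1\<close>, then \<open>b = d\<close> when \<open>t = 1\<close> and \<open>b = c\<close> when \<open>t > 1\<close>; symmetrically \<open>a = d\<close>
  if \<open>t = 1 < s\<close>. If \<open>s > 1\<close> and \<open>t > 1\<close>, a coordinate with \<open>b \<noteq> c\<close> forces \<open>s\<close>, one with \<open>a \<noteq> d\<close>
  forces \<open>t\<close>. Then \<open>P\<close> and \<open>Q\<close> are never pushed outwards in the same coordinate, and so \<open>a\<close> and \<open>c\<close>
  arise by changing \<open>b\<close> and \<open>d\<close> on complementary parts of the set where these differ: \<open>a = c\<close>.\<close>

lemma no_node_between: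
  assumes nodes: "a \<in> hypercube_nodes" "b \<in> hypercube_nodes" "c \<in> hypercube_nodes"
      "d \<in> hypercube_nodes" "e \<in> hypercube_nodes"
    and st: "1 \<le> s" "1 \<le> t"
    and disj: "{a, b} \<inter> {c, d} = {}" and "e \<noteq> b" "e \<noteq> d"
    and e: "e \<in> closed_segment (a + s *\<^sub>R (b - a)) (c + t *\<^sub>R (d - c))"
  shows False
proof -
  obtain u where u: "0 \<le> u" "u \<le> 1"
    and eu: "e = (1 - u) *\<^sub>R (a + s *\<^sub>R (b - a)) + u *\<^sub>R (c + t *\<^sub>R (d - c))"
    using e by (auto simp: in_segment)
  have "u \<noteq> 0"
    using eu outer_node_ray[of a b s] outer_node_of_node[of e] nodes st \<open>e \<noteq> b\<close> by auto
  moreover have "u \<noteq> 1"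
    using eu outer_node_ray[of c d t] outer_node_of_node[of e] nodes st \<open>e \<noteq> d\<close> by auto
  ultimately have u: "0 < u" "u < 1" using u by auto
  have "e $ i = (1 - u) * (a $ i + s * (b $ i - a $ i)) + u * (c $ i + t * (d $ i - c $ i))" for i
    by (simp add: eu)
  note between = coordinate_between[OF nodes[THEN hypercube_nodes_cases] st u this]
  note cases = nodes[THEN hypercube_nodes_cases]
  have neq: "b \<noteq> d" "c \<noteq> b" "a \<noteq> d" "a \<noteq> c" using disj by auto
  have "s \<noteq> 1"
  proof
    assume "s = 1"
    show False
    proof (cases "t = 1")
      case True
      then have "b $ i = d $ i" for i using between(2)[of i] \<open>s = 1\<close> by auto
      then show False using neq by (simp add: vec_eq_iff)
    next
      case False
      then have "c $ i = b $ i" for i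
        using between(1,2)[of i] \<open>s = 1\<close> cases(2-4)[of i] by auto
      then show False using neq by (simp add: vec_eq_iff)
    qed
  qed
  have "t \<noteq> 1"
  proof
    assume "t = 1"
    then have "a $ i = d $ i" for i
      using between(1,2)[of i] \<open>s \<noteq> 1\<close> cases(1,2,4)[of i] by auto
    then show False using neq by (simp add: vec_eq_iff)
  qed
  have us: "(1 - u) * s = 1"
  proof -
    obtain i where "c $ i \<noteq> b $ i" using neq by (auto simp: vec_eq_iff)
    then show ?thesis
      using between(1,3)[of i] \<open>t \<noteq> 1\<close> cases(2-4)[of i] by auto
  qed
  have ut: "u * t = 1"
  proof -
    obtain i where "a $ i \<noteq> d $ i" using neq by (auto simp: vec_eq_iff)
    then show ?thesis
      using between(1,4)[of i] \<open>s \<noteq> 1\<close> cases(1,2,4)[of i] by auto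
  qed
  have "a $ i = c $ i" for i
    using between(1,2)[of i] between(5)[OF us ut, of i] \<open>s \<noteq> 1\<close> \<open>t \<noteq> 1\<close> cases(1-4)[of i] by auto
  then show False using neq by (simp add: vec_eq_iff)
qed

lemma card_nodes_on_three_links:
  assumes A: "A \<subseteq> hypercube_nodes \<inter> closed_segment X P"
    and B: "B \<subseteq> hypercube_nodes \<inter> closed_segment P Q"
    and C: "C \<subseteq> hypercube_nodes \<inter> closed_segment Q Y"
    and disj: "A \<inter> B = {}" "A \<inter> C = {}" "B \<inter> C = {}"
  shows "card A + card B + card C \<le> 4"
proof -
  have C': "C \<subseteq> hypercube_nodes \<inter> closed_segment Y Q"
    using C by (simp add: closed_segment_commute)
  have "B = {}" if "card A = 2" "card C = 2"
  proof (rule ccontr)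
    obtain a s where a: "A = {a, outer_node P}" "1 \<le> s" "P = a + s *\<^sub>R (outer_node P - a)"
      using outer_node_in_pair[OF A \<open>card A = 2\<close>] by metis
    obtain c t where c: "C = {c, outer_node Q}" "1 \<le> t" "Q = c + t *\<^sub>R (outer_node Q - c)"
      using outer_node_in_pair[OF C' \<open>card C = 2\<close>] by metis
    assume "B \<noteq> {}"
    then obtain e where "e \<in> B" by blast
    show False
    proof (rule no_node_between)
      show "e \<in> closed_segment (a + s *\<^sub>R (outer_node P - a)) (c + t *\<^sub>R (outer_node Q - c))"
        using B \<open>e \<in> B\<close> a(3) c(3) by auto
    qed (use A B C \<open>e \<in> B\<close> disj a(1,2) c(1,2) in auto)
  qed
  then show ?thesis
    using card_nodes_on_two_links[OF A B disj(1)] card_nodes_on_two_links[OF B C disj(3)]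
      card_nodes_on_segment_le[OF A] card_nodes_on_segment_le[OF C]
    by (cases "card A = 2 \<and> card C = 2") auto
qed

section \<open>Counting\<close>

lemma card_hypercube_nodes: "card (hypercube_nodes :: (real ^ 'n::finite) set) = 2 ^ CARD('n)"
proof -
  let ?f = "\<lambda>I :: 'n set. (\<chi> i. if i \<in> I then 1 else 0) :: real ^ 'n"
  have "bij_betw ?f (Pow UNIV) hypercube_nodes"
    by (rule bij_betw_byWitness[where f' = "\<lambda>x. {i. x $ i = 1}"])
      (auto simp: hypercube_nodes_def vec_eq_iff)
  then show ?thesis
    by (metis bij_betw_same_card card_Pow finite_class.finite_UNIV)
qed

text \<open>The index set has two elements more than a multiple of three because the left-over pair
  contributes at most 3, one less than a full triple.\<close>

lemma sum_le_by_triples: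
  fixes f :: "nat \<Rightarrow> nat"
  assumes "f 0 + f 1 \<le> 3" and "\<And>i. f i + f (i + 1) + f (i + 2) \<le> 4"
  shows "(\<Sum>i<3 * q + 2. f i) \<le> 4 * q + 3"
proof (induction q)
  case 0
  then show ?case using assms(1) by (simp add: numeral_2_eq_2)
next
  case (Suc q)
  have "3 * Suc q + 2 = Suc (Suc (Suc (3 * q + 2)))" by simp
  then have "(\<Sum>i<3 * Suc q + 2. f i) = (\<Sum>i<3 * q + 2. f i)
      + (f (3 * q + 2) + f (3 * q + 2 + 1) + f (3 * q + 2 + 2))"
    by (simp only: sum.lessThan_Suc) (simp add: numeral_eq_Suc)
  also have "\<dots> \<le> (4 * q + 3) + 4"
    by (intro add_mono Suc.IH assms(2))
  finally show ?case by simp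
qed

lemma card_nodes_on_chain_le:
  "card (hypercube_nodes \<inter> polygonal_chain (3 * q + 2) S) \<le> 4 * q + 3"
proof -
  define A where "A i = hypercube_nodes \<inter> closed_segment (S (i + 1)) (S (i + 2))" for i
  \<comment> \<open>The nodes that no earlier link covers.\<close>
  define B where "B = disjointed A"
  have B: "B i \<subseteq> hypercube_nodes \<inter> closed_segment (S (i + 1)) (S (i + 2))" for i
    using disjointed_subset[of A i] by (simp add: A_def B_def)
  have disj: "B i \<inter> B j = {}" if "i \<noteq> j" for i j
    using disjoint_family_disjointed[of A] that by (auto simp: disjoint_family_on_def B_def)
  have "hypercube_nodes \<inter> polygonal_chain (3 * q + 2) S = (\<Union>i<3 * q + 2. A i)"
  proof -
    have "{1..3 * q + 2} = Suc ` {..<3 * q + 2}"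
      by (simp add: image_Suc_lessThan)
    then show ?thesis by (auto simp: polygonal_chain_def A_def)
  qed
  also have "\<dots> = (\<Union>i<3 * q + 2. B i)"
    using finite_UN_disjointed_eq[of A] by (simp add: B_def lessThan_atLeast0)
  also have "card \<dots> \<le> (\<Sum>i<3 * q + 2. card (B i))"
    by (rule card_UN_le) simp
  also have "\<dots> \<le> 4 * q + 3"
  proof (rule sum_le_by_triples)
    show "card (B 0) + card (B 1) \<le> 3"
      using card_nodes_on_two_links[OF B[of 0], of "B 1" "S 3"] B[of 1] disj[of 0 1]
      by (simp add: numeral_eq_Suc)
    show "card (B i) + card (B (i + 1)) + card (B (i + 2)) \<le> 4" for i
      using card_nodes_on_three_links[OF B[of i], of "B (i + 1)" "S (i + 3)" "B (i + 2)" "S (i + 4)"]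
        B[of "i + 1"] B[of "i + 2"] disj[of i "i + 1"] disj[of i "i + 2"] disj[of "i + 1" "i + 2"]
      by (simp add: numeral_eq_Suc)
  qed
  finally show ?thesis .
qed

lemma polygonal_chain_mono: "m \<le> n \<Longrightarrow> polygonal_chain m S \<subseteq> polygonal_chain n S"
  unfolding polygonal_chain_def by (rule UN_mono) auto

theorem theorem2p2:
  fixes k :: nat
  assumes "CARD('n::finite) = k" and "k \<ge> 2"
  shows "min_link_length (hypercube_nodes :: (real ^ 'n) set) \<ge> 3 * 2 ^ (k - 2)"
proof (rule ccontr)
  \<comment> \<open>A chain with fewer than \<open>3 * (q + 1)\<close> links has at most \<open>3 * q + 2\<close> of them; extending it to
    exactly that number only adds points.\<close>
  let ?H = "hypercube_nodes :: (real ^ 'n) set"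
  define q :: nat where "q = 2 ^ (k - 2) - 1"
  have q: "2 ^ (k - 2) = q + 1" by (simp add: q_def)
  assume "\<not> min_link_length ?H \<ge> 3 * 2 ^ (k - 2)"
  then have "min_link_length ?H \<le> 3 * q + 2" using q by linarith
  then obtain S where "?H \<subseteq> polygonal_chain (3 * q + 2) S"
    using min_link_length_attained[where 'n = 'n] polygonal_chain_mono by blast
  then have "card ?H \<le> 4 * q + 3"
    using card_nodes_on_chain_le[of q S] by (simp add: Int_absorb2)
  moreover have "card ?H = 2 ^ (2 + (k - 2))"
    using card_hypercube_nodes[where 'n = 'n] assms by (simp only: le_add_diff_inverse)
  ultimately show False using q by (simp add: power_add)
qed

end
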